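(* For every integer $d$ with $1\leq d<\infty$, the graph property "there exists a vertex of degree at least $d$", for graphs on the vertex set $\mathbb{N}$, is $\infty$-elusive.
   Context: Let $[\mathbb{N}]^2=\{\{n,k\}: n,k\in\mathbb{N},\ n\neq k\}$. A graph on $\mathbb{N}$ is a subset $G\subseteq[\mathbb{N}]^2$, so the set of graphs is $2^{[\mathbb{N}]^2}$. A graph property is an isomorphism-invariant subset $\mathcal{S}\subseteq 2^{[\mathbb{N}]^2}$. Degrees may be infinite. The game $G(\mathcal{S})$. Two players, Seeker and Hider, colour the edges of the complete graph on $\mathbb{N}$ with red, white, green. Initially all edges are white. In each turn Seeker picks a white edge and Hider recolours it green or red. The game terminates after infinitely many (that is, $\omega$ many) turns. Let $R_\infty,W_\infty,G_\infty$ be the sets of red, white and green edges at the end, and let $\mathcal{P}_\infty=\{G\subseteq[\mathbb{N}]^2: G_\infty\subseteq G\subseteq G_\infty\cup W_\infty\}$. Seeker wins if and only if $W_\infty\neq\emptyset$ and either $\mathcal{P}_\infty\subseteq\mathcal{S}$ or $\mathcal{P}_\infty\subseteq 2^{[\mathbb{N}]^2}\setminus\mathcal{S}$; otherwise Hider wins. The property $\mathcal{S}$ is $\infty$-elusive if Seeker does not have a winning strategy in $G(\mathcal{S})$. *)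

theory Defs
  imports "HOL-Library.Ramsey" "HOL-Library.Extended_Nat"
begin

type_synonym edge = "nat set"
type_synonym graph = "edge set"

abbreviation edges :: "edge set" where
  "edges \<equiv> nsets UNIV 2"

definition graph_property :: "graph set \<Rightarrow> bool" where
  "graph_property S \<longleftrightarrow> S \<subseteq> Pow edges \<and>
     (\<forall>\<pi> :: nat \<Rightarrow> nat. bij \<pi> \<longrightarrow> (\<forall>G\<in>S. (`) \<pi> ` G \<in> S))"

text \<open>The game. A move records the edge picked by Seeker together with Hider's reply; a history is
  the list of the moves made so far, the earliest first. The strategies of Seeker may depend on the
  whole history.\<close>

datatype colour = Red | White | Green

type_synonym move = "edge \<times> colour"

definition colouring :: "move list \<Rightarrow> edge \<Rightarrow> colour" where
  "colouring h = fold (\<lambda>(e, r) c. c(e := r)) h (\<lambda>_. White)"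

inductive legal :: "move list \<Rightarrow> bool" where
  start: "legal []"
| turn: "\<lbrakk>legal h; e \<in> edges; colouring h e = White; r \<in> {Red, Green}\<rbrakk> \<Longrightarrow> legal (h @ [(e, r)])"

definition history :: "(nat \<Rightarrow> move) \<Rightarrow> nat \<Rightarrow> move list" where
  "history p n = map p [0..<n]"

definition legal_play :: "(nat \<Rightarrow> move) \<Rightarrow> bool" where
  "legal_play p \<longleftrightarrow> (\<forall>n. legal (history p n))"

text \<open>In a legal play an edge changes its colour at most once, so the final colour of an edge is red
  or green as soon as it has this colour at some finite stage.\<close>

definition final_red :: "(nat \<Rightarrow> move) \<Rightarrow> edge set" where
  "final_red p = {e \<in> edges. \<exists>n. colouring (history p n) e = Red}"

definition final_green :: "(nat \<Rightarrow> move) \<Rightarrow> edge set" where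
  "final_green p = {e \<in> edges. \<exists>n. colouring (history p n) e = Green}"

definition final_white :: "(nat \<Rightarrow> move) \<Rightarrow> edge set" where
  "final_white p = {e \<in> edges. \<forall>n. colouring (history p n) e = White}"

definition possible_graphs :: "(nat \<Rightarrow> move) \<Rightarrow> graph set" where
  "possible_graphs p = {G. G \<subseteq> edges \<and> final_green p \<subseteq> G \<and> G \<subseteq> final_green p \<union> final_white p}"

definition seeker_wins :: "graph set \<Rightarrow> (nat \<Rightarrow> move) \<Rightarrow> bool" where
  "seeker_wins S p \<longleftrightarrow> final_white p \<noteq> {} \<and>
     (possible_graphs p \<subseteq> S \<or> possible_graphs p \<subseteq> Pow edges - S)"

definition seeker_strategy :: "(move list \<Rightarrow> edge) \<Rightarrow> bool" where
  "seeker_strategy \<sigma> \<longleftrightarrow> (\<forall>h. legal h \<longrightarrow> \<sigma> h \<in> edges \<and> colouring h (\<sigma> h) = White)"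

definition follows :: "(nat \<Rightarrow> move) \<Rightarrow> (move list \<Rightarrow> edge) \<Rightarrow> bool" where
  "follows p \<sigma> \<longleftrightarrow> (\<forall>n. fst (p n) = \<sigma> (history p n))"

definition winning_strategy :: "graph set \<Rightarrow> (move list \<Rightarrow> edge) \<Rightarrow> bool" where
  "winning_strategy S \<sigma> \<longleftrightarrow> seeker_strategy \<sigma> \<and>
     (\<forall>p. legal_play p \<and> follows p \<sigma> \<longrightarrow> seeker_wins S p)"

definition infty_elusive :: "graph set \<Rightarrow> bool" where
  "infty_elusive S \<longleftrightarrow> \<not> (\<exists>\<sigma>. winning_strategy S \<sigma>)"

definition degree :: "graph \<Rightarrow> nat \<Rightarrow> enat" where
  "degree G v = (let E = {e \<in> G. v \<in> e} in if finite E then enat (card E) else \<infinity>)"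

definition has_vertex_of_degree_ge :: "nat \<Rightarrow> graph set" where
  "has_vertex_of_degree_ge d = {G. G \<subseteq> edges \<and> (\<exists>v. degree G v \<ge> enat d)}"

lemma degree_image:
  assumes "bij \<pi>"
  shows "degree ((`) \<pi> ` G) (\<pi> v) = degree G v"
proof -
  have inj: "inj \<pi>" using assms by (rule bij_is_inj)
  have eq: "{e \<in> (`) \<pi> ` G. \<pi> v \<in> e} = (`) \<pi> ` {e \<in> G. v \<in> e}"
    using inj by (auto dest: injD)
  have inj2: "inj_on ((`) \<pi>) A" for A
    using inj by (auto simp: inj_on_def inj_image_eq_iff)
  show ?thesis
    unfolding degree_def Let_def eq using inj2 by (simp add: finite_image_iff card_image)
qed

lemma graph_property_has_vertex_of_degree_ge: "graph_property (has_vertex_of_degree_ge d)"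
  unfolding graph_property_def
proof (intro conjI allI impI ballI)
  show "has_vertex_of_degree_ge d \<subseteq> Pow edges"
    by (auto simp: has_vertex_of_degree_ge_def)
next
  fix \<pi> :: "nat \<Rightarrow> nat" and G
  assume bij: "bij \<pi>" and G: "G \<in> has_vertex_of_degree_ge d"
  have "\<pi> ` e \<in> edges" if "e \<in> edges" for e
    using that bij_is_inj[OF bij] by (auto simp: nsets_def card_image inj_on_subset)
  with G have "(`) \<pi> ` G \<subseteq> edges"
    by (auto simp: has_vertex_of_degree_ge_def)
  moreover obtain v where "enat d \<le> degree G v"
    using G by (auto simp: has_vertex_of_degree_ge_def)
  then have "enat d \<le> degree ((`) \<pi> ` G) (\<pi> v)"
    by (simp add: degree_image[OF bij])
  ultimately show "(`) \<pi> ` G \<in> has_vertex_of_degree_ge d"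
    by (auto simp: has_vertex_of_degree_ge_def)
qed

end

theory Submission
  imports Defs
begin

text \<open>
  Call a vertex saturated if its green degree is \<open>d - 1\<close>. Hider may never paint an edge at a
  saturated vertex green, so that the green graph keeps all degrees below \<open>d\<close>. Painting every other
  edge green is too generous, however: for \<open>d = 2\<close> Seeker could reserve an edge \<open>{u, v}\<close>, let Hider
  build a green perfect matching on the remaining vertices, and then ask for everything but
  \<open>{u, v}\<close>. Hider therefore saturates the vertices one after the other: an edge becomes green only if
  neither end is saturated and all vertices below its smaller end are saturated. For \<open>d = 1\<close> all
  vertices are saturated from the start, and Hider always answers red.

  Suppose that some edge is white at the end of a play against this strategy. The green graph does not
  have the property, so it suffices that the green and white edges together have it. If every vertex
  gets saturated, then an end of the white edge has \<open>d - 1\<close> green edges and a white one. Otherwise let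
  \<open>u\<close> be the least vertex that is never saturated. Once all smaller vertices are saturated, every new
  green edge contains \<open>u\<close>, hence the green graph is finite. A vertex \<open>v > u\<close> off the green graph is
  never saturated, so from that time on Seeker cannot ask for \<open>{u, v}\<close> without receiving green, which
  is absurd: such a green edge would put \<open>v\<close> on the green graph. Thus \<open>{u, v}\<close> is white for all but
  finitely many \<open>v\<close>, and \<open>u\<close> has infinite degree in the union.
\<close>

section \<open>Lower bounds on degrees\<close>

text \<open>Finite witnesses turn all comparisons with the extended natural number \<^const>\<open>degree\<close> into
  statements about finite sets, whether the degree is finite or not.\<close>

lemma degree_ge_iff:
  "enat k \<le> degree G v \<longleftrightarrow> (\<exists>F. F \<subseteq> {e \<in> G. v \<in> e} \<and> finite F \<and> card F = k)"
proof (cases "finite {e \<in> G. v \<in> e}")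
  case True
  then show ?thesis
    by (auto simp: degree_def Let_def dest: card_mono elim: obtain_subset_with_card_n)
next
  case False
  then show ?thesis
    using infinite_arbitrarily_large[OF False, of k] by (auto simp: degree_def Let_def)
qed

lemma degree_geI: "F \<subseteq> {e \<in> G. v \<in> e} \<Longrightarrow> finite F \<Longrightarrow> card F = k \<Longrightarrow> enat k \<le> degree G v"
  unfolding degree_ge_iff by (intro exI conjI)

lemma degree_geE:
  assumes "enat k \<le> degree G v"
  obtains F where "F \<subseteq> {e \<in> G. v \<in> e}" and "finite F" and "card F = k"
  using assms unfolding degree_ge_iff by (elim exE conjE)

lemma degree_ge_mono:
  assumes "enat k \<le> degree G v" and "G \<subseteq> H"
  shows "enat k \<le> degree H v"
proof -
  obtain F where "F \<subseteq> {e \<in> G. v \<in> e}" "finite F" "card F = k"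
    using assms(1) by (rule degree_geE)
  with assms(2) show ?thesis by (intro degree_geI[of F]) auto
qed

lemma degree_ge_Union_chain:
  assumes "enat k \<le> degree (\<Union>n. G n) v" and "incseq (G :: nat \<Rightarrow> graph)"
  shows "\<exists>n. enat k \<le> degree (G n) v"
proof -
  obtain F where F: "F \<subseteq> {e \<in> (\<Union>n. G n). v \<in> e}" "finite F" "card F = k"
    using assms(1) by (rule degree_geE)
  have "\<exists>n. F \<subseteq> G n"
    using F(2,1)
  proof (induction F rule: finite_induct)
    case (insert e F)
    from insert.prems have "F \<subseteq> {e \<in> (\<Union>n. G n). v \<in> e}" "e \<in> (\<Union>n. G n)" by simp_all
    then obtain m n where "e \<in> G m" "F \<subseteq> G n" using insert.IH by (elim UN_E) metis
    moreover have "G m \<subseteq> G (max m n)" "G n \<subseteq> G (max m n)"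
      using assms(2) by (auto simp: incseq_def)
    ultimately have "insert e F \<subseteq> G (max m n)" by auto
    then show ?case ..
  qed simp
  then obtain n where "F \<subseteq> G n" ..
  with F have "enat k \<le> degree (G n) v" by (intro degree_geI[of F]) auto
  then show ?thesis ..
qed

text \<open>The inequality, instead of equality, makes saturation monotone in the graph.\<close>

definition saturated :: "nat \<Rightarrow> graph \<Rightarrow> nat \<Rightarrow> bool" where
  "saturated d G v \<longleftrightarrow> enat (d - 1) \<le> degree G v"

lemma saturated_mono: "saturated d G v \<Longrightarrow> G \<subseteq> H \<Longrightarrow> saturated d H v"
  unfolding saturated_def by (rule degree_ge_mono)

lemma degree_ge_insert_imp_saturated:
  assumes "enat d \<le> degree (insert e G) v"
  shows "saturated d G v"
proof -
  obtain F where F: "F \<subseteq> {x \<in> insert e G. v \<in> x}" "finite F" "card F = d"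
    using assms by (rule degree_geE)
  have "d - 1 \<le> card (F - {e})"
    using F by (cases "e \<in> F") auto
  then obtain F' where "F' \<subseteq> F - {e}" "card F' = d - 1" "finite F'"
    by (rule obtain_subset_with_card_n)
  with F show ?thesis unfolding saturated_def by (intro degree_geI[of F']) auto
qed

lemma saturated_imp_degree_ge_insert:
  assumes "saturated d G v" and "v \<in> e" and "e \<notin> G" and "1 \<le> d"
  shows "enat d \<le> degree (insert e G) v"
proof -
  obtain F where F: "F \<subseteq> {x \<in> G. v \<in> x}" "finite F" "card F = d - 1"
    using assms(1) unfolding saturated_def by (rule degree_geE)
  with assms have "card (insert e F) = d" by (subst card_insert_disjoint) auto
  with F assms(2) show ?thesis
    by (intro degree_geI[of "insert e F"]) auto
qed

section \<open>Final colours in legal plays\<close>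

lemma colouring_snoc: "colouring (h @ [(e, r)]) = (colouring h)(e := r)"
  by (simp add: colouring_def)

lemma legal_colouring_iff:
  assumes "legal h"
  shows "colouring h e = White \<longleftrightarrow> e \<notin> fst ` set h"
    and "colouring h e = Green \<longleftrightarrow> (e, Green) \<in> set h"
    and "fst ` set h \<subseteq> edges"
proof -
  have "(colouring h e = White \<longleftrightarrow> e \<notin> fst ` set h) \<and>
    (colouring h e = Green \<longleftrightarrow> (e, Green) \<in> set h) \<and> fst ` set h \<subseteq> edges"
    using assms
  proof (induction arbitrary: e rule: legal.induct)
    case start
    show ?case by (simp add: colouring_def)
  next
    case (turn h a r)
    \<comment> \<open>The picked edge was white, so no earlier move mentions it.\<close>
    have "a \<notin> fst ` set h" using turn.IH[of a] turn.hyps by blast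
    then have "(a, Green) \<notin> set h" by force
    with turn.IH[of e] turn.hyps show ?case by (auto simp: colouring_snoc)
  qed
  then show "colouring h e = White \<longleftrightarrow> e \<notin> fst ` set h"
    and "colouring h e = Green \<longleftrightarrow> (e, Green) \<in> set h"
    and "fst ` set h \<subseteq> edges" by blast+
qed

definition green_edges :: "move list \<Rightarrow> graph" where
  "green_edges h = {e. (e, Green) \<in> set h}"

lemma finite_green_edges: "finite (green_edges h)"
proof (rule finite_subset)
  show "green_edges h \<subseteq> fst ` set h" unfolding green_edges_def by force
qed simp

lemma set_history: "set (history p n) = p ` {..<n}"
  by (auto simp: history_def)

lemma incseq_green_edges_history: "incseq (\<lambda>n. green_edges (history p n))"
  by (force simp: incseq_def green_edges_def set_history)

lemma final_green_eq:
  assumes "legal_play p"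
  shows "final_green p = (\<Union>n. green_edges (history p n))"
  using assms legal_colouring_iff(2,3)
  unfolding final_green_def legal_play_def green_edges_def by fastforce

lemma final_white_eq:
  assumes "legal_play p"
  shows "final_white p = edges - range (\<lambda>n. fst (p n))"
proof -
  have "(\<forall>n. colouring (history p n) e = White) \<longleftrightarrow> e \<notin> range (\<lambda>n. fst (p n))" for e
    using assms legal_colouring_iff(1) unfolding legal_play_def
    by (auto simp: set_history image_image)
  then show ?thesis unfolding final_white_def by blast
qed

section \<open>Hider's strategy\<close>

definition hider_reply :: "nat \<Rightarrow> move list \<Rightarrow> edge \<Rightarrow> colour" where
  "hider_reply d h e =
    (if (\<forall>v\<in>e. \<not> saturated d (green_edges h) v) \<and> (\<forall>w<Min e. saturated d (green_edges h) w)
     then Green else Red)"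

primrec play_history :: "nat \<Rightarrow> (move list \<Rightarrow> edge) \<Rightarrow> nat \<Rightarrow> move list" where
  "play_history d \<sigma> 0 = []"
| "play_history d \<sigma> (Suc n) = (let h = play_history d \<sigma> n in h @ [(\<sigma> h, hider_reply d h (\<sigma> h))])"

lemma exists_play_against:
  assumes "seeker_strategy \<sigma>"
  obtains p where "legal_play p" and "follows p \<sigma>"
    and "\<And>n. snd (p n) = hider_reply d (history p n) (fst (p n))"
proof
  define p where "p n = (let h = play_history d \<sigma> n in (\<sigma> h, hider_reply d h (\<sigma> h)))" for n
  have hist: "history p n = play_history d \<sigma> n" for n
    by (induction n) (simp_all add: history_def p_def Let_def)
  have "legal (play_history d \<sigma> n)" for n
  proof (induction n)
    case (Suc n)
    with assms have "\<sigma> (play_history d \<sigma> n) \<in> edges"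
      "colouring (play_history d \<sigma> n) (\<sigma> (play_history d \<sigma> n)) = White"
      unfolding seeker_strategy_def by blast+
    with Suc show ?case by (auto simp: Let_def hider_reply_def intro!: legal.turn)
  qed (simp add: legal.start)
  then show "legal_play p" by (simp add: legal_play_def hist)
  show "follows p \<sigma>" by (simp add: follows_def hist) (simp add: p_def Let_def)
  show "snd (p n) = hider_reply d (history p n) (fst (p n))" for n
    by (simp add: hist) (simp add: p_def Let_def)
qed

lemma green_edges_history_Suc:
  assumes "snd (p n) = hider_reply d (history p n) (fst (p n))"
  shows "green_edges (history p (Suc n)) =
    (if hider_reply d (history p n) (fst (p n)) = Green
     then insert (fst (p n)) (green_edges (history p n)) else green_edges (history p n))"
  using assms by (cases "p n") (auto simp: green_edges_def history_def)

text \<open>An increase of the green degree of \<open>v\<close> to \<open>d\<close> would require a green reply at the already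
  saturated vertex \<open>v\<close>.\<close>

lemma green_degree_less:
  assumes reply: "\<And>n. snd (p n) = hider_reply d (history p n) (fst (p n))"
    and "1 \<le> d"
  shows "\<not> enat d \<le> degree (green_edges (history p n)) v"
proof (induction n)
  case 0
  show ?case using assms(2) by (simp add: history_def green_edges_def degree_def zero_enat_def)
next
  case (Suc n)
  let ?G = "green_edges (history p n)" and ?e = "fst (p n)"
  show ?case
  proof
    assume d: "enat d \<le> degree (green_edges (history p (Suc n))) v"
    with Suc have green: "hider_reply d (history p n) ?e = Green"
      and ins: "enat d \<le> degree (insert ?e ?G) v"
      by (auto simp: green_edges_history_Suc[OF reply] split: if_splits)
    have "v \<in> ?e"
    proof (rule ccontr)
      assume "v \<notin> ?e"
      then have "{x \<in> insert ?e ?G. v \<in> x} = {x \<in> ?G. v \<in> x}" by blast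
      with ins Suc show False by (simp add: degree_def)
    qed
    moreover have "saturated d ?G v"
      using ins by (rule degree_ge_insert_imp_saturated)
    ultimately show False using green by (simp add: hider_reply_def split: if_splits)
  qed
qed

text \<open>The crucial point: a vertex that Hider fails to saturate has kept enough white edges.\<close>

lemma infinitely_many_white_at_unsaturated:
  assumes legal: "legal_play p"
    and reply: "\<And>n. snd (p n) = hider_reply d (history p n) (fst (p n))"
    and unsat: "\<And>n. \<not> saturated d (green_edges (history p n)) u"
    and sat: "\<And>w. w < u \<Longrightarrow> \<exists>n. saturated d (green_edges (history p n)) w"
  shows "infinite {e \<in> final_white p. u \<in> e}"
proof -
  let ?G = "\<lambda>n. green_edges (history p n)"
  have mono: "?G m \<subseteq> ?G n" if "m \<le> n" for m n
    using incseq_green_edges_history that by (rule incseqD)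
  obtain f where f: "\<And>w. w < u \<Longrightarrow> saturated d (?G (f w)) w"
    using sat by metis
  define t where "t = Max (insert 0 (f ` {..<u}))"
  have below: "saturated d (?G n) w" if "w < u" "t \<le> n" for w n
  proof -
    have "f w \<le> t" using that(1) by (auto simp: t_def)
    with that show ?thesis by (meson f mono saturated_mono le_trans)
  qed
  have p_edges: "fst (p n) \<in> edges" for n
    using legal_colouring_iff(3)[of "history p (Suc n)"] legal
    by (auto simp: legal_play_def set_history)
  \<comment> \<open>From time \<open>t\<close> on, a green edge not containing \<open>u\<close> would lie entirely above the unsaturated
    vertex \<open>u\<close> or contain a saturated vertex below \<open>u\<close>.\<close>
  have step: "u \<in> fst (p n)" if "t \<le> n" "snd (p n) = Green" for n
  proof (rule ccontr)
    assume u: "u \<notin> fst (p n)"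
    let ?e = "fst (p n)"
    have "finite ?e" "?e \<noteq> {}" using p_edges[of n] by (auto simp: nsets_def)
    then have "Min ?e \<in> ?e" by simp
    moreover have "\<forall>v\<in>?e. \<not> saturated d (?G n) v" "\<forall>w<Min ?e. saturated d (?G n) w"
      using that(2) unfolding reply by (auto simp: hider_reply_def split: if_splits)
    ultimately show False using below that(1) unsat u by (metis linorder_neqE_nat)
  qed
  have "final_green p \<subseteq> ?G t \<union> {e \<in> final_green p. u \<in> e}"
  proof
    fix e assume e: "e \<in> final_green p"
    then obtain n where n: "p n = (e, Green)"
      by (force simp: final_green_eq[OF legal] green_edges_def set_history)
    show "e \<in> ?G t \<union> {e \<in> final_green p. u \<in> e}"
    proof (cases "n < t")
      case True
      then have "e \<in> ?G t" using n by (force simp: green_edges_def set_history)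
      then show ?thesis by blast
    next
      case False
      then show ?thesis using step[of n] n e by simp
    qed
  qed
  moreover have "finite {e \<in> final_green p. u \<in> e}"
  proof (rule ccontr)
    assume "infinite {e \<in> final_green p. u \<in> e}"
    then have "enat (d - 1) \<le> degree (\<Union>n. ?G n) u"
      by (simp add: degree_def final_green_eq[OF legal])
    with unsat show False
      using degree_ge_Union_chain[OF _ incseq_green_edges_history] unfolding saturated_def by blast
  qed
  ultimately have fin: "finite (final_green p)"
    by (meson finite_UnI finite_green_edges finite_subset)

  define B where "B = \<Union> (final_green p) \<union> \<Union> (fst ` p ` {..<t}) \<union> {..u}"
  have "finite B"
    unfolding B_def using fin p_edges
    by (auto simp: final_green_def nsets_def)
  have white: "{u, v} \<in> final_white p" if "v \<notin> B" for v
  proof -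
    have v: "u < v" "v \<notin> \<Union> (final_green p)" "\<And>n. n < t \<Longrightarrow> v \<notin> fst (p n)"
      using that by (auto simp: B_def)
    have "fst (p n) \<noteq> {u, v}" for n
    proof
      assume e: "fst (p n) = {u, v}"
      then have "t \<le> n" using v(3)[of n] by (cases "n < t") auto
      \<comment> \<open>Since \<open>u\<close> is unsaturated, \<open>d - 1\<close> is positive, and \<open>v\<close> has green degree 0.\<close>
      have "\<not> saturated d (?G n) v"
      proof
        assume "saturated d (?G n) v"
        moreover have "{e \<in> ?G n. v \<in> e} = {}"
          using v(2) by (auto simp: final_green_eq[OF legal])
        ultimately have "d - 1 = 0" by (simp add: saturated_def degree_def zero_enat_def)
        then show False using unsat[of n] by (simp add: saturated_def flip: zero_enat_def)
      qed
      moreover have "Min {u, v} = u" using v(1) by (simp add: min_def)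
      ultimately have "snd (p n) = Green"
        using unsat below \<open>t \<le> n\<close> by (simp add: reply hider_reply_def e)
      then have "p n = ({u, v}, Green)" using e by (metis prod.collapse)
      then have "{u, v} \<in> ?G (Suc n)" by (force simp: green_edges_def set_history)
      then show False using v(2) by (auto simp: final_green_eq[OF legal])
    qed
    moreover have "{u, v} \<in> edges" using v(1) by (simp add: nsets_def)
    ultimately show ?thesis by (auto simp: final_white_eq[OF legal])
  qed
  have "infinite (- B)" using \<open>finite B\<close> by (simp add: Compl_eq_Diff_UNIV)
  moreover have "inj_on (\<lambda>v. {u, v}) (- B)" by (auto simp: inj_on_def doubleton_eq_iff)
  ultimately have "infinite ((\<lambda>v. {u, v}) ` (- B))" by (simp add: finite_image_iff)
  moreover have "(\<lambda>v. {u, v}) ` (- B) \<subseteq> {e \<in> final_white p. u \<in> e}" using white by blast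
  ultimately show ?thesis using finite_subset by blast
qed

lemma hider_reply_wins:
  assumes legal: "legal_play p"
    and reply: "\<And>n. snd (p n) = hider_reply d (history p n) (fst (p n))"
    and "1 \<le> d"
  shows "\<not> seeker_wins (has_vertex_of_degree_ge d) p"
proof
  let ?G = "\<lambda>n. green_edges (history p n)" and ?GW = "final_green p \<union> final_white p"
  assume win: "seeker_wins (has_vertex_of_degree_ge d) p"
  then obtain e where e: "e \<in> final_white p" by (auto simp: seeker_wins_def)
  have edges: "final_green p \<subseteq> edges" "final_white p \<subseteq> edges"
    by (auto simp: final_green_def final_white_def)
  have "\<not> enat d \<le> degree (final_green p) v" for v
    using green_degree_less[OF reply assms(3)]
      degree_ge_Union_chain[OF _ incseq_green_edges_history]
    unfolding final_green_eq[OF legal] by blast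
  then have "final_green p \<notin> has_vertex_of_degree_ge d"
    by (simp add: has_vertex_of_degree_ge_def)
  moreover have "\<exists>v. enat d \<le> degree ?GW v"
  proof (cases "\<forall>v. \<exists>n. saturated d (?G n) v")
    case True
    obtain v where v: "v \<in> e"
      using e edges by (fastforce simp: nsets_def)
    from True obtain n where "saturated d (?G n) v" by blast
    moreover have "?G n \<subseteq> final_green p" by (auto simp: final_green_eq[OF legal])
    moreover have "e \<notin> final_green p"
      using e by (auto simp: final_green_def final_white_def)
    ultimately have "enat d \<le> degree (insert e (final_green p)) v"
      using v assms(3) by (meson saturated_mono saturated_imp_degree_ge_insert)
    then show ?thesis
      using e by (intro exI[of _ v]) (rule degree_ge_mono, auto)
  next
    case False
    then have "\<exists>u. \<not> (\<exists>n. saturated d (?G n) u)" by simp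
    then obtain u where unsat: "\<not> (\<exists>n. saturated d (?G n) u)"
      and sat: "\<And>w. w < u \<Longrightarrow> \<exists>n. saturated d (?G n) w"
      unfolding exists_least_iff[of "\<lambda>u. \<not> (\<exists>n. saturated d (?G n) u)"] by auto
    have "infinite {x \<in> final_white p. u \<in> x}"
    proof (rule infinitely_many_white_at_unsaturated[OF legal reply])
      show "\<not> saturated d (?G n) u" for n using unsat by simp
    qed (rule sat)
    then have "enat d \<le> degree (final_white p) u" by (simp add: degree_def)
    then have "enat d \<le> degree ?GW u" by (rule degree_ge_mono) simp
    then show ?thesis ..
  qed
  then have "?GW \<in> has_vertex_of_degree_ge d"
    using edges by (simp add: has_vertex_of_degree_ge_def)
  moreover have "final_green p \<in> possible_graphs p" "?GW \<in> possible_graphs p"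
    using edges by (auto simp: possible_graphs_def)
  ultimately show False using win unfolding seeker_wins_def by blast
qed

theorem theorem3p6:
  fixes d :: nat
  assumes "1 \<le> d"
  shows "infty_elusive (has_vertex_of_degree_ge d)"
  unfolding infty_elusive_def
proof
  assume "\<exists>\<sigma>. winning_strategy (has_vertex_of_degree_ge d) \<sigma>"
  then obtain \<sigma> where \<sigma>: "winning_strategy (has_vertex_of_degree_ge d) \<sigma>" ..
  then have "seeker_strategy \<sigma>" by (simp add: winning_strategy_def)
  then obtain p where p: "legal_play p" "follows p \<sigma>"
    and reply: "\<And>n. snd (p n) = hider_reply d (history p n) (fst (p n))"
    by (rule exists_play_against[where d = d]) (use that in blast)
  have "seeker_wins (has_vertex_of_degree_ge d) p"
    using \<sigma> p by (simp add: winning_strategy_def)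
  moreover have "\<not> seeker_wins (has_vertex_of_degree_ge d) p"
    using p(1) reply assms by (rule hider_reply_wins)
  ultimately show False by contradiction
qed

end
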